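(* Let $c_{\rm BSG}=\frac{21}{128}$, let $S\subseteq\mathbb F_2^n$ be nonempty and $\alpha,\rho_{\rm snd},\rho_{\rm cmp}\in(0,1)$. Fix a nonfailure record $D$ of the persistent BSG algorithm run on $S$ with these parameters, with associated fixed set $Y_D\subseteq S$, and suppose $$|Y_D|\ge c_{\rm BSG}\sqrt\alpha\,|S|.$$ Let $t\ge1$ be an integer fixed before sampling begins, and let $\rho_{\rm samp}\in(0,1)$. For each of $t$ requested samples, use an independent block of $$T:=\left\lceil\frac1{c_{\rm BSG}\sqrt\alpha}\log\frac t{\rho_{\rm samp}}\right\rceil$$ independent uniform samples from $S$, returning the first point of the block accepted by the membership predicate of $Y_D$. If any block is exhausted (contains no accepted point), return $\mathsf{FAIL}$. Then the procedure fails with probability at most $\rho_{\rm samp}$. Conditioned on success, the returned tuple has law $U_{Y_D}^{\otimes t}$. The procedure uses at most $tT$ samples from $S$ and $$O\!\left(t\,\alpha^{-9/2}\Lambda^3\log\frac{et}{\rho_{\rm samp}}\right)$$ membership queries to $S$.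
   Context: $\log$ is base two; $U_Y$ is the uniform distribution on $Y$ and $U_Y^{\otimes t}$ its $t$-fold product. $\Lambda:=1+n+\log\frac1\alpha+\log\frac1{\rho_{\rm snd}}+\log\frac1{\rho_{\rm cmp}}$. The persistent BSG algorithm takes deterministic membership access to and exact uniform samples from $S$ and parameters $\alpha,\rho_{\rm snd},\rho_{\rm cmp}\in(0,1)$, and returns $\mathsf{FAIL}$ or a finite record $D$. The only facts about a nonfailure record used here are: $D$ determines one fixed set $Y_D\subseteq S$ with a deterministic membership predicate, and evaluating this predicate at one point uses $O(\alpha^{-4}\Lambda^3)$ membership queries to $S$ (absolute implied constant). *)

theory Defs
  imports
    "HOL-Probability.Probability"
    "HOL-Library.Z2"
    "Jordan_Normal_Form.Matrix"
begin

text \<open>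
  The space \<open>\<F>\<^sub>2\<^sup>n\<close> is \<open>carrier_vec n :: bit vec set\<close>.

  Algorithms with oracle access to a set \<open>S\<close> are trees: \<open>Member x k\<close> asks whether \<open>x \<in> S\<close> and
  continues with the answer, \<open>Sample k\<close> draws a fresh uniform element of \<open>S\<close>.
  There is no other source of randomness.
\<close>

datatype ('a, 'r) prog =
    Return 'r
  | Member 'a "bool \<Rightarrow> ('a, 'r) prog"
  | Sample "'a \<Rightarrow> ('a, 'r) prog"

primrec bind_prog :: "('a, 'r) prog \<Rightarrow> ('r \<Rightarrow> ('a, 'q) prog) \<Rightarrow> ('a, 'q) prog" where
  "bind_prog (Return r) f = f r"
| "bind_prog (Member x k) f = Member x (\<lambda>b. bind_prog (k b) f)"
| "bind_prog (Sample k) f = Sample (\<lambda>x. bind_prog (k x) f)"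

text \<open>
  The joint law of the result, the number of samples drawn and the number of membership queries.
\<close>

primrec run :: "'a set \<Rightarrow> ('a, 'r) prog \<Rightarrow> ('r \<times> nat \<times> nat) pmf" where
  "run S (Return r) = return_pmf (r, 0, 0)"
| "run S (Member x k) = map_pmf (\<lambda>(r, s, q). (r, s, Suc q)) (run S (k (x \<in> S)))"
| "run S (Sample k) =
     bind_pmf (pmf_of_set S) (\<lambda>x. map_pmf (\<lambda>(r, s, q). (r, Suc s, q)) (run S (k x)))"

definition outcome :: "'a set \<Rightarrow> ('a, 'r) prog \<Rightarrow> 'r pmf" where
  "outcome S p = map_pmf fst (run S p)"

primrec deterministic :: "('a, 'r) prog \<Rightarrow> bool" where
  "deterministic (Return r) \<longleftrightarrow> True"
| "deterministic (Member x k) \<longleftrightarrow> (\<forall>b. deterministic (k b))"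
| "deterministic (Sample k) \<longleftrightarrow> False"

definition c_BSG :: real where
  "c_BSG = 21 / 128"

definition Lam :: "nat \<Rightarrow> real \<Rightarrow> real \<Rightarrow> real \<Rightarrow> real" where
  "Lam n \<alpha> \<rho>_snd \<rho>_cmp = 1 + real n + log 2 (1 / \<alpha>) + log 2 (1 / \<rho>_snd) + log 2 (1 / \<rho>_cmp)"

text \<open>
  The set \<open>Y\<^sub>D\<close>, given the family \<open>mem\<close> of membership programs; these consult the oracle for \<open>S\<close>.
  When \<open>mem D x\<close> is deterministic, its outcome is a point mass.
\<close>

definition record_set ::
  "('d \<Rightarrow> bit vec \<Rightarrow> (bit vec, bool) prog) \<Rightarrow> nat \<Rightarrow> bit vec set \<Rightarrow> 'd \<Rightarrow> bit vec set" where
  "record_set mem n S D = {x \<in> carrier_vec n. outcome S (mem D x) = return_pmf True}"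

text \<open>
  The persistent BSG algorithm enters only through the guarantees on its nonfailure records:
  \<open>bsg n \<alpha> \<rho>_snd \<rho>_cmp\<close> is the algorithm, with \<open>None\<close> for \<open>FAIL\<close>; the type \<open>'d\<close> of records is
  arbitrary; \<open>K\<close> is the implied constant of the bound on the cost of one membership evaluation.
\<close>

definition nonfailure_record ::
  "(nat \<Rightarrow> real \<Rightarrow> real \<Rightarrow> real \<Rightarrow> (bit vec, 'd option) prog) \<Rightarrow>
   nat \<Rightarrow> bit vec set \<Rightarrow> real \<Rightarrow> real \<Rightarrow> real \<Rightarrow> 'd \<Rightarrow> bool" where
  "nonfailure_record bsg n S \<alpha> \<rho>_snd \<rho>_cmp D \<longleftrightarrow>
     Some D \<in> set_pmf (outcome S (bsg n \<alpha> \<rho>_snd \<rho>_cmp))"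

definition persistent_BSG ::
  "real \<Rightarrow> (nat \<Rightarrow> real \<Rightarrow> real \<Rightarrow> real \<Rightarrow> (bit vec, 'd option) prog) \<Rightarrow>
   ('d \<Rightarrow> bit vec \<Rightarrow> (bit vec, bool) prog) \<Rightarrow> bool" where
  "persistent_BSG K bsg mem \<longleftrightarrow>
     (\<forall>n S \<alpha> \<rho>_snd \<rho>_cmp D.
        S \<subseteq> carrier_vec n \<longrightarrow> S \<noteq> {} \<longrightarrow>
        \<alpha> \<in> {0<..<1} \<longrightarrow> \<rho>_snd \<in> {0<..<1} \<longrightarrow> \<rho>_cmp \<in> {0<..<1} \<longrightarrow>
        nonfailure_record bsg n S \<alpha> \<rho>_snd \<rho>_cmp D \<longrightarrow>
        record_set mem n S D \<subseteq> S \<and>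
        (\<forall>x \<in> carrier_vec n. deterministic (mem D x) \<and>
           (\<forall>(b, s, q) \<in> set_pmf (run S (mem D x)).
              real q \<le> K * \<alpha> powr (- 4) * Lam n \<alpha> \<rho>_snd \<rho>_cmp ^ 3)))"

definition block_length :: "real \<Rightarrow> nat \<Rightarrow> real \<Rightarrow> nat" where
  "block_length \<alpha> t \<rho>_samp = nat \<lceil>1 / (c_BSG * sqrt \<alpha>) * log 2 (real t / \<rho>_samp)\<rceil>"

primrec draw_block :: "nat \<Rightarrow> ('a, 'a list) prog" where
  "draw_block 0 = Return []"
| "draw_block (Suc m) = Sample (\<lambda>x. bind_prog (draw_block m) (\<lambda>xs. Return (x # xs)))"

primrec first_accepted :: "('a \<Rightarrow> ('a, bool) prog) \<Rightarrow> 'a list \<Rightarrow> ('a, 'a option) prog" where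
  "first_accepted acc [] = Return None"
| "first_accepted acc (x # xs) =
     bind_prog (acc x) (\<lambda>b. if b then Return (Some x) else first_accepted acc xs)"

text \<open>
  \<open>block_sampler acc T t\<close> processes \<open>t\<close> independent blocks of \<open>T\<close> samples;
  it returns \<open>None\<close>, meaning \<open>FAIL\<close>, at the first exhausted block.
\<close>

primrec block_sampler ::
  "('a \<Rightarrow> ('a, bool) prog) \<Rightarrow> nat \<Rightarrow> nat \<Rightarrow> ('a, 'a list option) prog" where
  "block_sampler acc T 0 = Return (Some [])"
| "block_sampler acc T (Suc t) =
     bind_prog (draw_block T) (\<lambda>block.
     bind_prog (first_accepted acc block) (\<lambda>r.
       case r of
         None \<Rightarrow> Return None
       | Some y \<Rightarrow> bind_prog (block_sampler acc T t) (\<lambda>r'. Return (map_option ((#) y) r'))))"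

end

theory Submission
  imports Defs
begin

text \<open>
  Write \<open>p = |Y| / |S|\<close>. A block of \<open>T\<close> samples is exhausted with probability \<open>(1 - p)\<^sup>T\<close>, and otherwise
  its first accepted point is uniform on \<open>Y\<close> and independent of the fact that the block succeeded.
  So a block returns a point of \<open>U\<^sub>Y\<close> with probability \<open>a = 1 - (1 - p)\<^sup>T\<close> and fails otherwise.
  Such mixtures compose: all \<open>t\<close> blocks together return \<open>U\<^sub>Y\<^sup>\<otimes>\<^sup>t\<close> with probability \<open>a\<^sup>t\<close> and fail otherwise.
  The failure probability \<open>1 - a\<^sup>t \<le> t (1 - p)\<^sup>T \<le> t exp (- p T)\<close> is at most \<open>\<rho>\<close> since
  \<open>p T \<ge> log 2 (t / \<rho>) \<ge> ln (t / \<rho>)\<close>.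
\<close>

subsection \<open>Laws and costs of composed programs\<close>

text \<open>The oracle is fixed and every sample is fresh, so the second phase depends on the first
  only through its result, and the counters add.\<close>

lemma run_bind_prog:
  "run S (bind_prog p f) =
     bind_pmf (run S p) (\<lambda>(r, s, q). map_pmf (\<lambda>(r', s', q'). (r', s + s', q + q')) (run S (f r)))"
proof (induction p)
  case (Return r)
  show ?case by (simp add: bind_return_pmf case_prod_unfold)
next
  case (Member x k)
  then show ?case
    by (simp add: map_bind_pmf bind_map_pmf case_prod_unfold pmf.map_comp o_def)
next
  case (Sample k)
  then show ?case
    by (simp add: map_bind_pmf bind_map_pmf bind_assoc_pmf case_prod_unfold pmf.map_comp o_def)
qed

lemma outcome_Return [simp]: "outcome S (Return r) = return_pmf r"
  by (simp add: outcome_def)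

lemma outcome_Sample: "outcome S (Sample k) = bind_pmf (pmf_of_set S) (\<lambda>x. outcome S (k x))"
  by (simp add: outcome_def map_bind_pmf pmf.map_comp o_def case_prod_unfold)

lemma outcome_bind_prog:
  "outcome S (bind_prog p f) = bind_pmf (outcome S p) (\<lambda>r. outcome S (f r))"
  by (simp add: outcome_def run_bind_prog map_bind_pmf bind_map_pmf pmf.map_comp o_def
      case_prod_unfold)

text \<open>Without \<open>Sample\<close> nodes, the oracle answers select a single path through the
  tree. This settles the points outside \<open>record_set\<close>, whose definition speaks only of
  the outcome \<open>True\<close>: there the outcome must be the point mass at
  \<open>False\<close>.\<close>

lemma run_deterministic:
  assumes "deterministic p"
  shows "\<exists>r q. run S p = return_pmf (r, 0, q)"
  using assms
proof (induction p)
  case (Member x k)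
  then obtain r q where "run S (k (x \<in> S)) = return_pmf (r, 0, q)"
    by (metis deterministic.simps(2) rangeI)
  then show ?case by auto
qed auto

section \<open>Worst-case sample and query counts\<close>

definition cost_bounded :: "'a set \<Rightarrow> ('a, 'r) prog \<Rightarrow> nat \<Rightarrow> real \<Rightarrow> bool" where
  "cost_bounded S p a b \<longleftrightarrow> (\<forall>(r, s, q) \<in> set_pmf (run S p). s \<le> a \<and> real q \<le> b)"

lemma cost_bounded_mono:
  "cost_bounded S p a b \<Longrightarrow> a \<le> a' \<Longrightarrow> b \<le> b' \<Longrightarrow> cost_bounded S p a' b'"
  unfolding cost_bounded_def by fastforce

lemma cost_bounded_Return [simp]: "0 \<le> b \<Longrightarrow> cost_bounded S (Return r) a b"
  by (simp add: cost_bounded_def)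

text \<open>Only results that can occur constrain \<open>f\<close>. This is essential for the
  testing phase, whose cost is controlled only on blocks of length \<open>T\<close> with entries in
  \<open>S\<close>.\<close>

lemma cost_bounded_bind_prog:
  assumes "cost_bounded S p a b"
    and "\<And>r. r \<in> set_pmf (outcome S p) \<Longrightarrow> cost_bounded S (f r) a' b'"
  shows "cost_bounded S (bind_prog p f) (a + a') (b + b')"
  unfolding cost_bounded_def
proof safe
  fix r s q assume "(r, s, q) \<in> set_pmf (run S (bind_prog p f))"
  then obtain r1 s1 q1 s2 q2 where 1: "(r1, s1, q1) \<in> set_pmf (run S p)"
    and 2: "(r, s2, q2) \<in> set_pmf (run S (f r1))" and eq: "s = s1 + s2" "q = q1 + q2"
    by (auto simp: run_bind_prog)
  have "r1 \<in> set_pmf (outcome S p)"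
    using 1 by (force simp: outcome_def)
  then have "s2 \<le> a' \<and> real q2 \<le> b'"
    using assms(2) 2 unfolding cost_bounded_def by blast
  moreover have "s1 \<le> a \<and> real q1 \<le> b"
    using assms(1) 1 unfolding cost_bounded_def by blast
  ultimately show "s \<le> a + a'" "real q \<le> b + b'"
    using eq by auto
qed

section \<open>Laws and costs of the pieces of the block sampler\<close>

lemma outcome_draw_block: "outcome S (draw_block m) = replicate_pmf m (pmf_of_set S)"
  by (induction m) (simp_all add: outcome_Sample outcome_bind_prog)

lemma set_outcome_draw_block:
  assumes "finite S" "S \<noteq> {}"
  shows "set_pmf (outcome S (draw_block m)) = {xs. set xs \<subseteq> S \<and> length xs = m}"
  using assms by (auto simp: outcome_draw_block set_replicate_pmf set_pmf_of_set)

lemma cost_bounded_draw_block: "cost_bounded S (draw_block m) m 0"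
proof (induction m)
  case (Suc m)
  have *: "cost_bounded S (bind_prog (draw_block m) (\<lambda>xs. Return (x # xs))) (m + 0) (0 + 0)" for x
    by (rule cost_bounded_bind_prog[OF Suc]) simp
  show ?case
    unfolding cost_bounded_def
  proof safe
    fix r s q assume "(r, s, q) \<in> set_pmf (run S (draw_block (Suc m)))"
    then obtain x s' where
      "(r, s', q) \<in> set_pmf (run S (bind_prog (draw_block m) (\<lambda>xs. Return (x # xs))))" "s = Suc s'"
      by auto
    then show "s \<le> Suc m" "real q \<le> 0"
      using *[of x] unfolding cost_bounded_def by auto
  qed
qed simp

text \<open>Since each membership test has a point mass as outcome, all randomness sits in the block
  itself, and the law of a block becomes the image of a product law under
  \<open>find\<close>.\<close>

lemma outcome_first_accepted:
  assumes "\<And>x. x \<in> S \<Longrightarrow> outcome S (acc x) = return_pmf (x \<in> Y)" and "set xs \<subseteq> S"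
  shows "outcome S (first_accepted acc xs) = return_pmf (find (\<lambda>x. x \<in> Y) xs)"
  using assms(2)
  by (induction xs) (simp_all add: outcome_bind_prog assms(1) bind_return_pmf)

lemma cost_bounded_first_accepted:
  assumes "\<And>x. x \<in> S \<Longrightarrow> cost_bounded S (acc x) 0 b" and "0 \<le> b" and "set xs \<subseteq> S"
  shows "cost_bounded S (first_accepted acc xs) 0 (real (length xs) * b)"
  using assms(3)
proof (induction xs)
  case (Cons x xs)
  have "cost_bounded S (first_accepted acc (x # xs)) (0 + 0) (b + real (length xs) * b)"
    unfolding first_accepted.simps
    using Cons assms(1,2) by (intro cost_bounded_bind_prog) auto
  then show ?case by (simp add: algebra_simps)
qed simp

text \<open>Every point of a block is tested at most once, and stopping at an accepted point or at
  an exhausted block only saves work.\<close>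

lemma cost_bounded_block_sampler:
  assumes S: "finite S" "S \<noteq> {}"
    and acc: "\<And>x. x \<in> S \<Longrightarrow> cost_bounded S (acc x) 0 b" and b: "0 \<le> b"
  shows "cost_bounded S (block_sampler acc T t) (t * T) (real t * (real T * b))"
proof (induction t)
  case (Suc t)
  \<comment> \<open>The unsimplified sums follow the nested binds: drawing, testing, the remaining
    \<open>t\<close> blocks, and the final \<open>Return\<close>.\<close>
  have "cost_bounded S (block_sampler acc T (Suc t))
      (T + (0 + (t * T + 0))) (0 + (real T * b + (real t * (real T * b) + 0)))"
    unfolding block_sampler.simps
  proof (intro cost_bounded_bind_prog)
    show "cost_bounded S (draw_block T) T 0"
      by (rule cost_bounded_draw_block)
  next
    fix xs assume "xs \<in> set_pmf (outcome S (draw_block T))"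
    then have "set xs \<subseteq> S" "length xs = T"
      by (auto simp: set_outcome_draw_block[OF S])
    then show "cost_bounded S (first_accepted acc xs) 0 (real T * b)"
      using cost_bounded_first_accepted[of S acc b xs, OF acc b] by blast
  next
    fix r :: "'a option"
    show "cost_bounded S (case r of None \<Rightarrow> Return None | Some y \<Rightarrow>
        bind_prog (block_sampler acc T t) (\<lambda>r'. Return (map_option ((#) y) r')))
        (t * T + 0) (real t * (real T * b) + 0)"
    proof (cases r)
      case None
      then show ?thesis using b by simp
    next
      case (Some y)
      then show ?thesis
        unfolding Some option.case by (intro cost_bounded_bind_prog[OF Suc]) simp
    qed
  qed
  then show ?case by (simp add: algebra_simps)
qed simp

subsection \<open>Sampling that may fail\<close>

text \<open>The coin is flipped independently of the draw from \<open>u\<close>; this independence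
  makes such laws closed under sequencing.\<close>

definition success_pmf :: "real \<Rightarrow> 'b pmf \<Rightarrow> 'b option pmf" where
  "success_pmf a u =
     bind_pmf (bernoulli_pmf a) (\<lambda>b. if b then map_pmf Some u else return_pmf None)"

lemma success_pmf_1: "success_pmf 1 u = map_pmf Some u"
proof -
  have "bernoulli_pmf 1 = return_pmf True"
  proof (rule pmf_eqI)
    show "pmf (bernoulli_pmf 1) b = pmf (return_pmf True) b" for b
      by (cases b) simp_all
  qed
  then show ?thesis by (simp add: success_pmf_def bind_return_pmf)
qed

lemma
  assumes "0 \<le> a" "a \<le> 1"
  shows pmf_success_pmf_None: "pmf (success_pmf a u) None = 1 - a"
    and pmf_success_pmf_Some: "pmf (success_pmf a u) (Some y) = a * pmf u y"
proof -
  have "pmf (map_pmf Some u) None = 0"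
    by (simp add: pmf_eq_0_set_pmf)
  moreover have "pmf (map_pmf Some u) (Some y) = pmf u y"
    by (rule pmf_map_inj') simp
  ultimately show "pmf (success_pmf a u) None = 1 - a" "pmf (success_pmf a u) (Some y) = a * pmf u y"
    using assms by (simp_all add: success_pmf_def pmf_bind)
qed

lemma bernoulli_pmf_mult:
  assumes "0 \<le> a" "a \<le> 1" "0 \<le> b" "b \<le> 1"
  shows "bind_pmf (bernoulli_pmf a) (\<lambda>x. if x then bernoulli_pmf b else return_pmf False) =
    bernoulli_pmf (a * b)"
proof (rule pmf_eqI)
  fix x
  have "a * b \<le> 1" using assms by (simp add: mult_le_one)
  then show "pmf (bind_pmf (bernoulli_pmf a) (\<lambda>x. if x then bernoulli_pmf b else return_pmf False)) x =
    pmf (bernoulli_pmf (a * b)) x"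
    using assms by (cases x) (simp_all add: pmf_bind algebra_simps)
qed

text \<open>The second coin does not depend on the value \<open>y\<close>, so it can be flipped
  before \<open>y\<close> is drawn and merged with the first into one coin of bias
  \<open>a * b\<close>.\<close>

lemma success_pmf_bind:
  assumes "0 \<le> a" "a \<le> 1" "0 \<le> b" "b \<le> 1"
  shows "bind_pmf (success_pmf a u) (\<lambda>r. case r of None \<Rightarrow> return_pmf None
      | Some y \<Rightarrow> map_pmf (map_option (g y)) (success_pmf b v)) =
    success_pmf (a * b) (bind_pmf u (\<lambda>y. map_pmf (g y) v))"
proof -
  let ?w = "\<lambda>b. if b then map_pmf Some (bind_pmf u (\<lambda>y. map_pmf (g y) v)) else return_pmf None"
  have *: "map_pmf (map_option (g y)) (if c then map_pmf Some v else return_pmf None) =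
      (if c then map_pmf Some (map_pmf (g y) v) else return_pmf None)" for c y
    by (simp add: pmf.map_comp o_def)
  \<comment> \<open>\<open>bind_commute_pmf\<close> exchanges the draw of \<open>y\<close> with the
    second coin.\<close>
  have "bind_pmf u (\<lambda>y. map_pmf (map_option (g y)) (success_pmf b v)) =
      bind_pmf (bernoulli_pmf b) ?w"
    unfolding success_pmf_def map_bind_pmf *
    by (subst bind_commute_pmf) (intro bind_pmf_cong refl, simp add: map_bind_pmf)
  \<comment> \<open>If the first coin fails, the second is replaced by the constant
    \<open>False\<close>, so both cases share the continuation \<open>?w\<close>.\<close>
  then have "bind_pmf (success_pmf a u) (\<lambda>r. case r of None \<Rightarrow> return_pmf None
      | Some y \<Rightarrow> map_pmf (map_option (g y)) (success_pmf b v)) =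
    bind_pmf (bernoulli_pmf a) (\<lambda>x. bind_pmf (if x then bernoulli_pmf b else return_pmf False) ?w)"
    unfolding success_pmf_def[of a]
    by (auto simp: bind_assoc_pmf bind_map_pmf bind_return_pmf intro!: bind_pmf_cong)
  also have "\<dots> = success_pmf (a * b) (bind_pmf u (\<lambda>y. map_pmf (g y) v))"
    by (simp add: bind_assoc_pmf[symmetric] bernoulli_pmf_mult[OF assms] success_pmf_def)
  finally show ?thesis .
qed

text \<open>Each value has mass \<open>a * pmf u y\<close>, and conditioning divides by the success
  probability \<open>a\<close>, which must be positive.\<close>

lemma cond_success_pmf:
  assumes "0 < a" "a \<le> 1"
  shows "cond_pmf (success_pmf a u) {r. r \<noteq> None} = map_pmf Some u"
proof -
  have "{r. r \<noteq> None} = - {None :: 'a option}" by auto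
  then have prob: "measure_pmf.prob (success_pmf a u) {r. r \<noteq> None} = a"
    using assms measure_pmf.prob_compl[of "{None}" "success_pmf a u"]
    by (simp add: measure_pmf_single pmf_success_pmf_None Compl_eq_Diff_UNIV)
  then have ne: "set_pmf (success_pmf a u) \<inter> {r. r \<noteq> None} \<noteq> {}"
    using assms measure_pmf_zero_iff[of "success_pmf a u" "{r. r \<noteq> None}"] by auto
  show ?thesis
  proof (rule pmf_eqI)
    fix r
    show "pmf (cond_pmf (success_pmf a u) {r. r \<noteq> None}) r = pmf (map_pmf Some u) r"
    proof (cases r)
      case None
      then show ?thesis
        unfolding None pmf_cond[OF ne] by (simp add: pmf_eq_0_set_pmf)
    next
      case (Some y)
      have "pmf (map_pmf Some u) (Some y) = pmf u y"
        by (rule pmf_map_inj') simp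
      then show ?thesis
        unfolding Some pmf_cond[OF ne] prob using assms by (simp add: pmf_success_pmf_Some)
    qed
  qed
qed

subsection \<open>Rejection sampling in blocks\<close>

text \<open>Induction on the first sample: it is accepted with probability \<open>p\<close> and is
  then uniform on \<open>Y\<close>; otherwise a block of length \<open>T\<close> remains. The
  success probability thus obeys \<open>a' = p + (1 - p) * a\<close>.\<close>

lemma find_replicate_pmf_of_set:
  assumes S: "finite S" and Y: "Y \<subseteq> S" "Y \<noteq> {}"
  shows "map_pmf (find (\<lambda>x. x \<in> Y)) (replicate_pmf T (pmf_of_set S)) =
    success_pmf (1 - (1 - real (card Y) / real (card S)) ^ T) (pmf_of_set Y)"
proof (induction T)
  case 0
  \<comment> \<open>An empty block is always exhausted, matching
    \<open>1 - (1 - p) ^ 0 = 0\<close>.\<close>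
  have "return_pmf None = success_pmf 0 (pmf_of_set Y)"
  proof (rule pmf_eqI)
    fix r :: "'a option"
    show "pmf (return_pmf None) r = pmf (success_pmf 0 (pmf_of_set Y)) r"
      by (cases r) (simp_all add: pmf_success_pmf_None pmf_success_pmf_Some)
  qed
  then show ?case by simp
next
  case (Suc T)
  have fin: "finite Y" and ne: "S \<noteq> {}"
    using S Y finite_subset by auto
  define p where "p = real (card Y) / real (card S)"
  have cS: "real (card S) > 0" and cY: "real (card Y) > 0"
    using S ne fin Y by (auto simp: card_gt_0_iff)
  have "card Y \<le> card S" using S Y card_mono by blast
  then have p: "0 < p" "p \<le> 1" using cS cY by (auto simp: p_def)
  define B where "B = success_pmf (1 - (1 - p) ^ T) (pmf_of_set Y)"
  have a: "0 \<le> 1 - (1 - p) ^ k" "1 - (1 - p) ^ k \<le> 1" for k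
    using p by (auto simp: power_le_one)
  have "map_pmf (find (\<lambda>x. x \<in> Y)) (replicate_pmf (Suc T) (pmf_of_set S)) =
    bind_pmf (pmf_of_set S) (\<lambda>x. if x \<in> Y then return_pmf (Some x) else
      map_pmf (find (\<lambda>x. x \<in> Y)) (replicate_pmf T (pmf_of_set S)))"
    unfolding replicate_pmf.simps map_bind_pmf
    by (intro bind_pmf_cong refl) (simp add: map_pmf_def bind_return_pmf)
  also have "\<dots> = bind_pmf (pmf_of_set S) (\<lambda>x. if x \<in> Y then return_pmf (Some x) else B)"
    unfolding Suc B_def p_def ..
  also have "\<dots> = success_pmf (1 - (1 - p) ^ Suc T) (pmf_of_set Y)"
  proof (rule pmf_eqI)
    fix r
    let ?f = "\<lambda>x. pmf (if x \<in> Y then return_pmf (Some x) else B) r"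
    \<comment> \<open>Split by acceptance of the first sample; on \<open>S - Y\<close> the summand
      is constant.\<close>
    have "sum ?f S = sum ?f Y + sum ?f (S - Y)"
      using sum.subset_diff[OF Y(1) S, of ?f] by (simp only: add.commute)
    also have "sum ?f (S - Y) = (real (card S) - real (card Y)) * pmf B r"
      using Y fin S by (simp add: card_Diff_subset card_mono)
    finally have "pmf (bind_pmf (pmf_of_set S) (\<lambda>x. if x \<in> Y then return_pmf (Some x) else B)) r =
        sum ?f Y / card S + (1 - p) * pmf B r"
      using S ne cS by (simp add: pmf_bind_pmf_of_set p_def field_simps)
    also have "\<dots> = pmf (success_pmf (1 - (1 - p) ^ Suc T) (pmf_of_set Y)) r"
    proof (cases r)
      case None
      then have "sum ?f Y = 0" by (intro sum.neutral) simp
      then show ?thesis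
        unfolding None B_def pmf_success_pmf_None[OF a] by simp
    next
      case (Some y)
      have "sum ?f Y = (\<Sum>x\<in>Y. if x = y then 1 else 0)"
        unfolding Some by (intro sum.cong refl) (auto simp: indicator_def)
      also have "\<dots> = indicator Y y" using fin by (simp add: indicator_def)
      finally have *: "sum ?f Y = indicator Y y" .
      \<comment> \<open>A given point of \<open>Y\<close> comes first with probability
        \<open>1 / card S\<close>, that is, \<open>p\<close> times its mass under the uniform law on
        \<open>Y\<close>.\<close>
      have **: "indicator Y y / real (card S) = p * pmf (pmf_of_set Y) y"
        using fin Y cY cS by (simp add: p_def field_simps)
      show ?thesis
        unfolding * ** unfolding Some B_def pmf_success_pmf_Some[OF a]
        by (simp add: algebra_simps)
    qed
    finally show "pmf (bind_pmf (pmf_of_set S) (\<lambda>x. if x \<in> Y then return_pmf (Some x) else B)) r =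
      pmf (success_pmf (1 - (1 - p) ^ Suc T) (pmf_of_set Y)) r" .
  qed
  finally show ?case unfolding p_def .
qed

text \<open>Blocks use disjoint fresh samples, so \<open>success_pmf_bind\<close> multiplies their
  success probabilities while the accepted points accumulate into a product law.\<close>

lemma outcome_block_sampler:
  assumes S: "finite S" and Y: "Y \<subseteq> S" "Y \<noteq> {}"
    and acc: "\<And>x. x \<in> S \<Longrightarrow> outcome S (acc x) = return_pmf (x \<in> Y)"
  shows "outcome S (block_sampler acc T t) =
    success_pmf ((1 - (1 - real (card Y) / real (card S)) ^ T) ^ t)
      (replicate_pmf t (pmf_of_set Y))"
proof (induction t)
  case 0
  show ?case by (simp add: success_pmf_1)
next
  case (Suc t)
  define a where "a = 1 - (1 - real (card Y) / real (card S)) ^ T"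
  have ne: "S \<noteq> {}" using Y by auto
  have "card Y \<le> card S" using S Y card_mono by blast
  moreover have "card S > 0" using S ne by (simp add: card_gt_0_iff)
  ultimately have "0 \<le> 1 - real (card Y) / real (card S)" "1 - real (card Y) / real (card S) \<le> 1"
    by (simp_all add: divide_le_eq_1)
  then have a: "0 \<le> a" "a \<le> 1" by (auto simp: a_def power_le_one)
  then have at: "0 \<le> a ^ t" "a ^ t \<le> 1" by (auto simp: power_le_one)
  have "bind_pmf (outcome S (draw_block T)) (\<lambda>xs. outcome S (first_accepted acc xs)) =
      bind_pmf (outcome S (draw_block T)) (\<lambda>xs. return_pmf (find (\<lambda>x. x \<in> Y) xs))"
    by (intro bind_pmf_cong refl outcome_first_accepted acc)
      (auto simp: set_outcome_draw_block[OF S ne])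
  then have block: "bind_pmf (outcome S (draw_block T)) (\<lambda>xs. outcome S (first_accepted acc xs)) =
      success_pmf a (pmf_of_set Y)"
    using find_replicate_pmf_of_set[OF S Y]
    by (simp add: outcome_draw_block map_pmf_def a_def)
  have "outcome S (block_sampler acc T (Suc t)) =
    bind_pmf (success_pmf a (pmf_of_set Y)) (\<lambda>r. case r of None \<Rightarrow> return_pmf None
      | Some y \<Rightarrow> map_pmf (map_option ((#) y)) (success_pmf (a ^ t) (replicate_pmf t (pmf_of_set Y))))"
    unfolding block[symmetric] bind_assoc_pmf block_sampler.simps outcome_bind_prog
    by (intro bind_pmf_cong refl)
      (auto simp: outcome_bind_prog Suc map_pmf_def a_def split: option.split)
  also have "\<dots> = success_pmf (a ^ Suc t)
      (bind_pmf (pmf_of_set Y) (\<lambda>y. map_pmf ((#) y) (replicate_pmf t (pmf_of_set Y))))"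
    unfolding success_pmf_bind[OF a at] by simp
  also have "bind_pmf (pmf_of_set Y) (\<lambda>y. map_pmf ((#) y) (replicate_pmf t (pmf_of_set Y))) =
      replicate_pmf (Suc t) (pmf_of_set Y)"
    by (simp add: map_pmf_def)
  finally show ?case unfolding a_def .
qed

section \<open>Estimates for the failure probability and the block length\<close>

lemma block_failure_bound:
  fixes p \<rho> :: real
  assumes p: "0 \<le> p" "p \<le> 1" and t: "t \<ge> 1" and \<rho>: "0 < \<rho>" "\<rho> < 1"
    and T: "p * real T \<ge> log 2 (real t / \<rho>)"
  shows "1 - (1 - (1 - p) ^ T) ^ t \<le> \<rho>"
proof -
  let ?q = "(1 - p) ^ T"
  have x: "real t / \<rho> \<ge> 1" using t \<rho> by (simp add: field_simps)
  have q: "?q \<le> 1" "0 \<le> ?q" using p by (auto simp: power_le_one)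
  \<comment> \<open>Bernoulli's inequality serves as the union bound over the \<open>t\<close>
    blocks.\<close>
  have "1 + real t * (- ?q) \<le> (1 + - ?q) ^ t"
    by (rule Bernoulli_inequality) (use q in simp)
  then have "1 - (1 - ?q) ^ t \<le> real t * ?q" by simp
  also have "?q \<le> exp (- p) ^ T"
    using p exp_ge_add_one_self[of "- p"] by (intro power_mono) auto
  also have "\<dots> = exp (- (p * real T))"
    by (simp add: exp_of_nat_mult[symmetric] mult.commute)
  \<comment> \<open>Passing from base two to \<open>ln\<close> only loses, because
    \<open>ln 2 \<le> 1\<close> and the argument is at least 1.\<close>
  also have "\<dots> \<le> exp (- ln (real t / \<rho>))"
  proof -
    have "ln (real t / \<rho>) \<ge> 0" using x by simp
    moreover have "ln (2 :: real) \<le> 1" using ln_2_less_1 by simp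
    ultimately have "ln (real t / \<rho>) * ln 2 \<le> ln (real t / \<rho>)"
      by (rule mult_left_le[rotated])
    then have "ln (real t / \<rho>) \<le> log 2 (real t / \<rho>)"
      by (simp add: log_def pos_le_divide_eq)
    with T show ?thesis by simp
  qed
  also have "\<dots> = \<rho> / real t" using \<rho> t by (simp add: exp_minus)
  finally show ?thesis using t by (simp add: mult_left_mono)
qed

text \<open>The ceiling adds at most 1. This is absorbed in two steps: \<open>w \<ge> 1\<close>
  gives \<open>w * L + 1 \<le> w * (1 + L)\<close>, and the factor \<open>exp 1\<close> inside the
  logarithm contributes at least 1.\<close>

lemma block_length_le:
  assumes \<alpha>: "0 < \<alpha>" "\<alpha> < 1" and t: "t \<ge> 1" and \<rho>: "0 < \<rho>" "\<rho> < 1"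
  shows "real (block_length \<alpha> t \<rho>) \<le> 128 / 21 * \<alpha> powr (- 1 / 2) * log 2 (exp 1 * real t / \<rho>)"
proof -
  define w where "w = 1 / (c_BSG * sqrt \<alpha>)"
  define L where "L = log 2 (real t / \<rho>)"
  have x: "real t / \<rho> > 1" using t \<rho> by (simp add: field_simps)
  then have L: "L \<ge> 0" by (simp add: L_def)
  have w: "w = 128 / 21 * \<alpha> powr (- 1 / 2)"
    using \<alpha> by (simp add: w_def c_BSG_def powr_minus_divide powr_half_sqrt)
  have "sqrt \<alpha> \<le> 1" using \<alpha> by simp
  then have "c_BSG * sqrt \<alpha> \<le> 1"
    unfolding c_BSG_def by linarith
  moreover have "c_BSG * sqrt \<alpha> > 0"
    using \<alpha> by (simp add: c_BSG_def)
  ultimately have w1: "w \<ge> 1" by (simp add: w_def)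
  have "log 2 (exp 1) \<ge> (1 :: real)" using ln_2_less_1 by (simp add: log_def)
  moreover have "log 2 (exp 1 * real t / \<rho>) = log 2 (exp 1) + L"
    using x \<rho> t by (simp add: L_def log_mult log_divide)
  ultimately have e: "log 2 (exp 1 * real t / \<rho>) \<ge> 1 + L" by simp
  \<comment> \<open>Nonnegativity ensures that \<open>nat\<close> does not truncate the
    ceiling.\<close>
  have "w * L \<ge> 0" using L w1 by simp
  then have "real (block_length \<alpha> t \<rho>) = of_int \<lceil>w * L\<rceil>"
    unfolding block_length_def w_def[symmetric] L_def[symmetric] by linarith
  also have "\<dots> \<le> w * L + 1" by linarith
  also have "\<dots> \<le> w * (1 + L)" using w1 by (simp add: algebra_simps)
  also have "\<dots> \<le> w * log 2 (exp 1 * real t / \<rho>)"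
    using e w1 by (intro mult_left_mono) auto
  finally show ?thesis unfolding w .
qed

text \<open>Finiteness makes \<open>card\<close> and \<open>pmf_of_set\<close> meaningful for every
  nonempty subset of the space.\<close>

lemma finite_carrier_vec_bit: "finite (carrier_vec n :: bit vec set)"
proof (rule finite_subset)
  have "bit \<in> {0, 1}" for bit :: bit by (cases bit) auto
  then have fin: "finite (UNIV :: bit set)"
    by (metis finite.emptyI finite.insertI finite_subset subsetI)
  then show "finite (vec_of_list ` {xs :: bit list. set xs \<subseteq> UNIV \<and> length xs = n})"
    by (intro finite_imageI finite_lists_length_eq)
  show "carrier_vec n \<subseteq> vec_of_list ` {xs :: bit list. set xs \<subseteq> UNIV \<and> length xs = n}"
  proof
    fix v :: "bit vec" assume "v \<in> carrier_vec n"
    then have "v = vec_of_list (list_of_vec v)" "length (list_of_vec v) = n"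
      by (auto simp: vec_list)
    then show "v \<in> vec_of_list ` {xs :: bit list. set xs \<subseteq> UNIV \<and> length xs = n}"
      by blast
  qed
qed

lemma Lam_ge_1:
  assumes "\<alpha> \<in> {0<..<1}" "\<rho>_snd \<in> {0<..<1}" "\<rho>_cmp \<in> {0<..<1}"
  shows "Lam n \<alpha> \<rho>_snd \<rho>_cmp \<ge> 1"
proof -
  have "log 2 (1 / x) \<ge> 0" if "x \<in> {0<..<1}" for x :: real
    using that by (simp add: field_simps)
  then show ?thesis using assms by (simp add: Lam_def)
qed

text \<open>\<open>C\<close> is quantified before the algorithm and all parameters, so for a given
  record type it depends on \<open>K\<close> alone. The product law is expressed on lists by
  \<open>replicate_pmf\<close>.\<close>

theorem proposition4p9:
  fixes K :: real
  shows "\<exists>C > 0.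
    \<forall>(bsg :: nat \<Rightarrow> real \<Rightarrow> real \<Rightarrow> real \<Rightarrow> (bit vec, 'd option) prog)
     (mem :: 'd \<Rightarrow> bit vec \<Rightarrow> (bit vec, bool) prog)
     (n :: nat) (S :: bit vec set) (\<alpha> :: real) (\<rho>_snd :: real) (\<rho>_cmp :: real)
     (D :: 'd) (t :: nat) (\<rho>_samp :: real).
      persistent_BSG K bsg mem \<longrightarrow>
      S \<subseteq> carrier_vec n \<longrightarrow> S \<noteq> {} \<longrightarrow>
      \<alpha> \<in> {0<..<1} \<longrightarrow> \<rho>_snd \<in> {0<..<1} \<longrightarrow> \<rho>_cmp \<in> {0<..<1} \<longrightarrow>
      nonfailure_record bsg n S \<alpha> \<rho>_snd \<rho>_cmp D \<longrightarrow>
      real (card (record_set mem n S D)) \<ge> c_BSG * sqrt \<alpha> * real (card S) \<longrightarrow>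
      t \<ge> 1 \<longrightarrow> \<rho>_samp \<in> {0<..<1} \<longrightarrow>
      (let Y = record_set mem n S D;
           T = block_length \<alpha> t \<rho>_samp;
           procedure = block_sampler (mem D) T t
       in measure_pmf.prob (outcome S procedure) {None} \<le> \<rho>_samp \<and>
          cond_pmf (outcome S procedure) {r. r \<noteq> None} =
            map_pmf Some (replicate_pmf t (pmf_of_set Y)) \<and>
          (\<forall>(r, s, q) \<in> set_pmf (run S procedure).
             s \<le> t * T \<and>
             real q \<le> C * (real t * \<alpha> powr (- 9 / 2) * Lam n \<alpha> \<rho>_snd \<rho>_cmp ^ 3
                          * log 2 (exp 1 * real t / \<rho>_samp))))"
proof -
  \<comment> \<open>The factor \<open>128 / 21\<close> is \<open>1 / c_BSG\<close>, from the block
    length. The absolute value allows any sign of \<open>K\<close>, and the summand 1 keeps the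
    constant positive when \<open>K = 0\<close>.\<close>
  let ?C = "\<bar>K\<bar> * (128 / 21) + 1"
  have "?C > 0" by (simp add: add_nonneg_pos)
  show ?thesis
  proof (rule exI[of _ ?C], intro conjI allI impI)
    show "?C > 0" by fact
  next
    fix bsg :: "nat \<Rightarrow> real \<Rightarrow> real \<Rightarrow> real \<Rightarrow> (bit vec, 'd option) prog"
      and mem :: "'d \<Rightarrow> bit vec \<Rightarrow> (bit vec, bool) prog"
      and n t :: nat and S :: "bit vec set" and \<alpha> \<rho>_snd \<rho>_cmp \<rho>_samp :: real and D :: 'd
    assume bsg: "persistent_BSG K bsg mem" and S: "S \<subseteq> carrier_vec n" "S \<noteq> {}"
      and \<alpha>: "\<alpha> \<in> {0<..<1}"
      and \<rho>: "\<rho>_snd \<in> {0<..<1}" "\<rho>_cmp \<in> {0<..<1}"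
      and D: "nonfailure_record bsg n S \<alpha> \<rho>_snd \<rho>_cmp D"
      and large: "real (card (record_set mem n S D)) \<ge> c_BSG * sqrt \<alpha> * real (card S)"
      and t: "t \<ge> 1" and \<rho>s: "\<rho>_samp \<in> {0<..<1}"
    define Y where "Y = record_set mem n S D"
    define T where "T = block_length \<alpha> t \<rho>_samp"
    define X where "X = \<alpha> powr (- 4) * Lam n \<alpha> \<rho>_snd \<rho>_cmp ^ 3"
    define M where "M = \<bar>K\<bar> * X"
    define p where "p = real (card Y) / real (card S)"
    have rec: "Y \<subseteq> S"
        "\<And>x. x \<in> carrier_vec n \<Longrightarrow> deterministic (mem D x)"
        "\<And>x b s q. x \<in> carrier_vec n \<Longrightarrow> (b, s, q) \<in> set_pmf (run S (mem D x)) \<Longrightarrow>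
           real q \<le> K * \<alpha> powr (- 4) * Lam n \<alpha> \<rho>_snd \<rho>_cmp ^ 3"
      using bsg[unfolded persistent_BSG_def, rule_format, OF S \<alpha> \<rho> D] unfolding Y_def by fast+
    have fin: "finite S" using S finite_carrier_vec_bit finite_subset by blast
    have Lam: "Lam n \<alpha> \<rho>_snd \<rho>_cmp \<ge> 1" using \<alpha> \<rho> by (rule Lam_ge_1)
    then have X: "X \<ge> 0" by (simp add: X_def)
    then have "M \<ge> 0" by (simp add: M_def)
    have KM: "K * \<alpha> powr (- 4) * Lam n \<alpha> \<rho>_snd \<rho>_cmp ^ 3 \<le> M"
      using mult_right_mono[OF abs_ge_self X, of K] by (simp add: M_def X_def mult.assoc)
    have cS: "real (card S) > 0" using fin S by (simp add: card_gt_0_iff)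
    have c: "c_BSG * sqrt \<alpha> > 0" using \<alpha> by (simp add: c_BSG_def)
    \<comment> \<open>The size hypothesis forces \<open>Y\<close> to be nonempty, so that its
      uniform law makes sense.\<close>
    have "c_BSG * sqrt \<alpha> * real (card S) > 0" using c cS by simp
    then have "card Y \<noteq> 0" using large unfolding Y_def[symmetric] by auto
    then have "Y \<noteq> {}" by auto
    have acc: "outcome S (mem D x) = return_pmf (x \<in> Y)"
      and cost: "cost_bounded S (mem D x) 0 M" if "x \<in> S" for x
    proof -
      have x: "x \<in> carrier_vec n" using that S by blast
      obtain b q where run: "run S (mem D x) = return_pmf (b, 0, q)"
        using run_deterministic[OF rec(2)[OF x]] by blast
      then have "outcome S (mem D x) = return_pmf b" by (simp add: outcome_def)
      then show "outcome S (mem D x) = return_pmf (x \<in> Y)"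
        using x by (simp add: Y_def record_set_def)
      have "real q \<le> M" using rec(3)[OF x] KM run by auto
      then show "cost_bounded S (mem D x) 0 M" by (simp add: cost_bounded_def run)
    qed
    have p: "p \<ge> c_BSG * sqrt \<alpha>" "p \<le> 1"
      using large cS card_mono[OF fin rec(1)] by (simp_all add: p_def Y_def field_simps)
    have law: "outcome S (block_sampler (mem D) T t) =
        success_pmf ((1 - (1 - p) ^ T) ^ t) (replicate_pmf t (pmf_of_set Y))"
      unfolding p_def by (rule outcome_block_sampler[OF fin rec(1) \<open>Y \<noteq> {}\<close> acc])
    \<comment> \<open>\<open>T\<close> is chosen so that \<open>p * T\<close> reaches this logarithm
      already for the smallest density \<open>p\<close> allowed.\<close>
    have "log 2 (real t / \<rho>_samp) = c_BSG * sqrt \<alpha> * (1 / (c_BSG * sqrt \<alpha>) * log 2 (real t / \<rho>_samp))"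
      unfolding mult.assoc[symmetric] using less_imp_neq[OF c] by simp
    also have "\<dots> \<le> c_BSG * sqrt \<alpha> * real T"
      using c unfolding T_def block_length_def by (intro mult_left_mono) linarith+
    also have "\<dots> \<le> p * real T" using p by (intro mult_right_mono) auto
    finally have fail: "1 - (1 - (1 - p) ^ T) ^ t \<le> \<rho>_samp"
      using p c t \<rho>s by (intro block_failure_bound) auto
    \<comment> \<open>Failure has probability at most \<open>\<rho>_samp < 1\<close>, so success has
      positive probability and can be conditioned on.\<close>
    have "0 \<le> (1 - p) ^ T" "(1 - p) ^ T \<le> 1" using p c by (auto simp: power_le_one)
    then have a: "(1 - (1 - p) ^ T) ^ t > 0" "(1 - (1 - p) ^ T) ^ t \<le> 1"
      using fail \<rho>s by (auto simp: power_le_one)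
    have queries: "real t * (real T * M) \<le>
        ?C * (real t * \<alpha> powr (- 9 / 2) * Lam n \<alpha> \<rho>_snd \<rho>_cmp ^ 3 * log 2 (exp 1 * real t / \<rho>_samp))"
    proof -
      define l where "l = log 2 (exp 1 * real t / \<rho>_samp)"
      define P where "P = \<alpha> powr (- 1 / 2)"
      have T: "real T \<le> 128 / 21 * P * l"
        unfolding T_def l_def P_def using \<alpha> t \<rho>s by (intro block_length_le) auto
      then have "P * l \<ge> 0" using of_nat_0_le_iff[of T, where 'a = real] by linarith
      \<comment> \<open>The exponent combines -4 from one membership evaluation with -1/2 from the
        block length.\<close>
      have powr: "\<alpha> powr (- 9 / 2) = \<alpha> powr (- 4) * P"
        by (simp add: P_def powr_add[symmetric])
      have "real t * (real T * M) \<le> real t * (128 / 21 * P * l * M)"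
        using T \<open>M \<ge> 0\<close> by (intro mult_left_mono mult_right_mono) auto
      also have "\<dots> = \<bar>K\<bar> * (128 / 21) * (real t * X * (P * l))" by (simp add: M_def)
      also have "\<dots> \<le> ?C * (real t * X * (P * l))"
        using X \<open>P * l \<ge> 0\<close> by (intro mult_right_mono) auto
      finally show ?thesis unfolding powr X_def l_def by (simp add: algebra_simps)
    qed
    have "cost_bounded S (block_sampler (mem D) T t) (t * T)
        (?C * (real t * \<alpha> powr (- 9 / 2) * Lam n \<alpha> \<rho>_snd \<rho>_cmp ^ 3 * log 2 (exp 1 * real t / \<rho>_samp)))"
      by (rule cost_bounded_mono[OF cost_bounded_block_sampler[where acc = "mem D",
            OF fin S(2) cost \<open>M \<ge> 0\<close>] order_refl queries])
    then show "let Y = record_set mem n S D;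
           T = block_length \<alpha> t \<rho>_samp;
           procedure = block_sampler (mem D) T t
       in measure_pmf.prob (outcome S procedure) {None} \<le> \<rho>_samp \<and>
          cond_pmf (outcome S procedure) {r. r \<noteq> None} =
            map_pmf Some (replicate_pmf t (pmf_of_set Y)) \<and>
          (\<forall>(r, s, q) \<in> set_pmf (run S procedure).
             s \<le> t * T \<and>
             real q \<le> ?C * (real t * \<alpha> powr (- 9 / 2) * Lam n \<alpha> \<rho>_snd \<rho>_cmp ^ 3
                          * log 2 (exp 1 * real t / \<rho>_samp)))"
      unfolding Let_def Y_def[symmetric] T_def[symmetric] law cost_bounded_def cond_success_pmf[OF a]
      using a fail by (simp add: measure_pmf_single pmf_success_pmf_None)
  qed
qed

end
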